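(* Assume that $\left(\Delta^{(n)}\right)^2\to 0$ as $n\to\infty$ and that all singular values $\mu_i$ of the kernel $H$ are distinct. Let $\epsilon>0$ (small) and let $P\in\mathbb{Z}^+$ be such that $\mu_P>\epsilon$ and $\mu_{P+1}\le\epsilon$. Then $$\lim_{n\to\infty}p^{(n)}=P=:p^*.$$ Moreover, there exists $n^*\in\mathbb{Z}^+$ such that $p^{(n)}=p^*$ for all $n\ge n^*$.
   Context: $H$ is a real, non-degenerate, square-integrable kernel on $\Omega_s\times\Omega_t$, with $\|H\|^2=\int_{\Omega_s}\int_{\Omega_t}H(s,t)^2\,dt\,ds<\infty$ and singular value expansion $H(s,t)=\sum_{i=1}^\infty\mu_i u_i(s)v_i(t)$ (convergent in mean), where $\{u_i\}$ and $\{v_i\}$ are orthonormal systems (left and right singular functions) and $\mu_1\ge\mu_2\ge\cdots>0$ are the singular values of $H$; $\|H\|^2=\sum_i\mu_i^2$. Galerkin discretization: $\{\psi_i\}_{i=1}^\infty$ and $\{\phi_j\}_{j=1}^\infty$ are orthonormal bases of $L^2(\Omega_s)$ and $L^2(\Omega_t)$. For each $n$, $A^{(n)}$ is the $n\times n$ matrix with entries $a^{(n)}_{ij}=\int_{\Omega_s}\int_{\Omega_t}\psi_i(s)H(s,t)\phi_j(t)\,dt\,ds$, $1\le i,j\le n$, and $\sigma_1^{(n)}\ge\cdots\ge\sigma_n^{(n)}>0$ are its singular values. Define $\left(\Delta^{(n)}\right)^2=\|H\|^2-\|A^{(n)}\|_F^2$ ($\|\cdot\|_F$ is the Frobenius norm).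 Numerical rank: for the given precision $\epsilon$, the numerical rank of $A^{(n)}$ is $p^{(n)}=\max\{i:\sigma^{(n)}_i>\epsilon\}$. *)

theory Defs
  imports "HOL-Analysis.Analysis" "Jordan_Normal_Form.Matrix"
begin

(* All sequences of singular functions, singular values and basis functions are
   indexed from 1; the value at index 0 is never used. *)

definition square_integrable :: "'a measure \<Rightarrow> ('a \<Rightarrow> real) \<Rightarrow> bool" where
  "square_integrable M f \<longleftrightarrow> f \<in> borel_measurable M \<and> integrable M (\<lambda>x. (f x)\<^sup>2)"

definition L2_inner :: "'a measure \<Rightarrow> ('a \<Rightarrow> real) \<Rightarrow> ('a \<Rightarrow> real) \<Rightarrow> real" where
  "L2_inner M f g = (\<integral>x. f x * g x \<partial>M)"

definition orthonormal_system :: "'a measure \<Rightarrow> (nat \<Rightarrow> 'a \<Rightarrow> real) \<Rightarrow> bool" where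
  "orthonormal_system M e \<longleftrightarrow>
     (\<forall>i\<ge>1. square_integrable M (e i)) \<and>
     (\<forall>i\<ge>1. \<forall>j\<ge>1. L2_inner M (e i) (e j) = (if i = j then 1 else 0))"

definition orthonormal_basis :: "'a measure \<Rightarrow> (nat \<Rightarrow> 'a \<Rightarrow> real) \<Rightarrow> bool" where
  "orthonormal_basis M e \<longleftrightarrow>
     orthonormal_system M e \<and>
     (\<forall>f. square_integrable M f \<longrightarrow>
        (\<lambda>n. \<integral>x. (f x - (\<Sum>i=1..n. L2_inner M f (e i) * e i x))\<^sup>2 \<partial>M) \<longlonglongrightarrow> 0)"

definition kernel_norm_sq ::
  "'a measure \<Rightarrow> 'b measure \<Rightarrow> ('a \<Rightarrow> 'b \<Rightarrow> real) \<Rightarrow> real" where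
  "kernel_norm_sq Ms Mt H = (\<integral>s. (\<integral>t. (H s t)\<^sup>2 \<partial>Mt) \<partial>Ms)"

definition square_integrable_kernel ::
  "'a measure \<Rightarrow> 'b measure \<Rightarrow> ('a \<Rightarrow> 'b \<Rightarrow> real) \<Rightarrow> bool" where
  "square_integrable_kernel Ms Mt H \<longleftrightarrow> square_integrable (Ms \<Otimes>\<^sub>M Mt) (\<lambda>(s, t). H s t)"

(* A degenerate (separable, finite-rank) kernel is a finite sum of products f(s) g(t). *)
definition degenerate_kernel ::
  "'a measure \<Rightarrow> 'b measure \<Rightarrow> ('a \<Rightarrow> 'b \<Rightarrow> real) \<Rightarrow> bool" where
  "degenerate_kernel Ms Mt H \<longleftrightarrow>
     (\<exists>(m::nat) f g.
        (\<forall>i\<in>{1..m}. square_integrable Ms (f i) \<and> square_integrable Mt (g i)) \<and>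
        (AE (s, t) in Ms \<Otimes>\<^sub>M Mt. H s t = (\<Sum>i=1..m. f i s * g i t)))"

definition singular_value_expansion ::
  "'a measure \<Rightarrow> 'b measure \<Rightarrow> ('a \<Rightarrow> 'b \<Rightarrow> real) \<Rightarrow>
   (nat \<Rightarrow> real) \<Rightarrow> (nat \<Rightarrow> 'a \<Rightarrow> real) \<Rightarrow> (nat \<Rightarrow> 'b \<Rightarrow> real) \<Rightarrow> bool" where
  "singular_value_expansion Ms Mt H \<mu> u v \<longleftrightarrow>
     orthonormal_system Ms u \<and> orthonormal_system Mt v \<and>
     (\<forall>i\<ge>1. \<mu> i \<ge> \<mu> (i + 1) \<and> \<mu> i > 0) \<and>
     (\<lambda>k. kernel_norm_sq Ms Mt (\<lambda>s t. H s t - (\<Sum>i=1..k. \<mu> i * u i s * v i t))) \<longlonglongrightarrow> 0"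

(* Matrix indices start at 0 in the matrix library, hence the successors. *)
definition galerkin_matrix ::
  "'a measure \<Rightarrow> 'b measure \<Rightarrow> ('a \<Rightarrow> 'b \<Rightarrow> real) \<Rightarrow>
   (nat \<Rightarrow> 'a \<Rightarrow> real) \<Rightarrow> (nat \<Rightarrow> 'b \<Rightarrow> real) \<Rightarrow> nat \<Rightarrow> real Matrix.mat" where
  "galerkin_matrix Ms Mt H \<psi> \<phi> n =
     Matrix.mat n n
       (\<lambda>(i, j). \<integral>s. (\<integral>t. \<psi> (Suc i) s * H s t * \<phi> (Suc j) t \<partial>Mt) \<partial>Ms)"

definition frobenius_norm :: "real Matrix.mat \<Rightarrow> real" where
  "frobenius_norm A = sqrt (\<Sum>i<dim_row A. \<Sum>j<dim_col A. (A $$ (i, j))\<^sup>2)"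

(* Orthogonal in the sense of orthonormal columns; the predicate orthogonal_mat
   of the matrix library does not normalise the columns. *)
definition real_orthogonal_mat :: "nat \<Rightarrow> real Matrix.mat \<Rightarrow> bool" where
  "real_orthogonal_mat n U \<longleftrightarrow> U \<in> carrier_mat n n \<and> transpose_mat U * U = 1\<^sub>m n"

(* sv 1 >= ... >= sv n >= 0 are the singular values of the square matrix A of size n,
   i.e. the diagonal of a singular value decomposition A = U diag(sv 1, ..., sv n) V^T. *)
definition singular_values :: "nat \<Rightarrow> real Matrix.mat \<Rightarrow> (nat \<Rightarrow> real) \<Rightarrow> bool" where
  "singular_values n A sv \<longleftrightarrow>
     (\<forall>i\<in>{1..n}. sv i \<ge> 0) \<and>
     (\<forall>i\<in>{1..n}. \<forall>j\<in>{1..n}. i \<le> j \<longrightarrow> sv j \<le> sv i) \<and>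
     (\<exists>U V. real_orthogonal_mat n U \<and> real_orthogonal_mat n V \<and>
        A = U * mat_diag n (\<lambda>k. sv (Suc k)) * transpose_mat V)"

definition Delta_sq ::
  "'a measure \<Rightarrow> 'b measure \<Rightarrow> ('a \<Rightarrow> 'b \<Rightarrow> real) \<Rightarrow>
   (nat \<Rightarrow> 'a \<Rightarrow> real) \<Rightarrow> (nat \<Rightarrow> 'b \<Rightarrow> real) \<Rightarrow> nat \<Rightarrow> real" where
  "Delta_sq Ms Mt H \<psi> \<phi> n =
     kernel_norm_sq Ms Mt H - (frobenius_norm (galerkin_matrix Ms Mt H \<psi> \<phi> n))\<^sup>2"

(* max {i. sv i > eps}, with the convention that the maximum of the empty set is 0. *)
definition numerical_rank :: "real \<Rightarrow> nat \<Rightarrow> (nat \<Rightarrow> real) \<Rightarrow> nat" where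
  "numerical_rank \<epsilon> n sv = Max (insert 0 {i\<in>{1..n}. sv i > \<epsilon>})"

end

theory Submission
  imports Defs "Jordan_Normal_Form.Determinant"
begin

text \<open>
  The kernel \<open>H\<close> acts as the bilinear form \<open>B(f, g) = \<langle>H, f \<otimes> g\<rangle>\<close>, and the Galerkin matrix represents
  the restriction of \<open>B\<close> to the spans of the first \<open>n\<close> basis functions. Two inequalities, one from
  above and one from below, pin down the singular values \<open>\<sigma>\<^sub>k\<close> of that matrix near the threshold
  \<open>\<epsilon>\<close>.

  From above, \<open>\<sigma>\<^sub>k \<le> \<mu>\<^sub>k\<close> for every \<open>n \<ge> k\<close> (\<open>galerkin_singular_value_le\<close>). This is the minimax argument.
  The right singular vectors for \<open>\<sigma>\<^sub>1, \<dots>, \<sigma>\<^sub>k\<close> give a \<open>k\<close>-dimensional space of functions, so some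
  nonzero \<open>g\<close> in it is orthogonal to the first \<open>k - 1\<close> of the \<open>v\<^sub>i\<close>. If \<open>f\<close> is the same combination of
  the left singular vectors, then \<open>B(f, g)\<close> is at least \<open>\<sigma>\<^sub>k\<close> times \<open>\<parallel>f\<parallel>\<^sup>2 = \<parallel>g\<parallel>\<^sup>2\<close> by the decomposition of
  the matrix and at most \<open>\<mu>\<^sub>k\<close> times it by the expansion of \<open>H\<close>.

  From below, \<open>\<mu>\<^sub>k\<^sup>2 - \<sigma>\<^sub>k\<^sup>2\<close> is at most the defect \<open>\<parallel>H\<parallel>\<^sup>2 - \<parallel>A\<parallel>\<^sup>2\<close> in Frobenius norm
  (\<open>galerkin_singular_value_defect\<close>): the defect is at least the sum over \<open>i \<le> n\<close> of
  \<open>\<mu>\<^sub>i\<^sup>2 - \<sigma>\<^sub>i\<^sup>2\<close>, because \<open>\<parallel>A\<parallel>\<^sup>2 = \<Sum> \<sigma>\<^sub>i\<^sup>2\<close> and, by Bessel's inequality, \<open>\<parallel>H\<parallel>\<^sup>2 \<ge> \<Sum> \<mu>\<^sub>i\<^sup>2\<close>;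
  and by the first inequality no term of that sum is negative.

  Once the defect is below \<open>\<mu>\<^sub>P\<^sup>2 - \<epsilon>\<^sup>2\<close>, the second inequality at index \<open>P\<close> gives \<open>\<sigma>\<^sub>P > \<epsilon>\<close>. The first at
  index \<open>P + 1\<close> gives that the next singular value is at most \<open>\<epsilon>\<close>. It does so even in the borderline
  case \<open>\<mu> (P + 1) = \<epsilon>\<close>, which convergence of the singular values alone could not decide.
\<close>

section \<open>Square-integrable functions\<close>

lemma square_integrable_mult_integrable:
  assumes "square_integrable M f" "square_integrable M g"
  shows "integrable M (\<lambda>x. f x * g x)"
proof (rule Bochner_Integration.integrable_bound)
  show "integrable M (\<lambda>x. (f x)\<^sup>2 + (g x)\<^sup>2)"
    using assms by (auto simp: square_integrable_def)
  show "(\<lambda>x. f x * g x) \<in> borel_measurable M"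
    using assms by (auto simp: square_integrable_def)
  have "\<bar>a * b\<bar> \<le> a\<^sup>2 + b\<^sup>2" for a b :: real
  proof -
    have "0 \<le> (\<bar>a\<bar> - \<bar>b\<bar>)\<^sup>2" "0 \<le> \<bar>a\<bar> * \<bar>b\<bar>" by simp_all
    then show ?thesis unfolding power2_diff abs_mult power2_abs by linarith
  qed
  then show "AE x in M. norm (f x * g x) \<le> norm ((f x)\<^sup>2 + (g x)\<^sup>2)"
    by simp
qed

lemma square_integrable_add:
  assumes "square_integrable M f" "square_integrable M g"
  shows "square_integrable M (\<lambda>x. f x + g x)"
proof -
  have "integrable M (\<lambda>x. (f x)\<^sup>2 + (g x)\<^sup>2 + 2 * (f x * g x))"
    using assms square_integrable_mult_integrable[OF assms]
    by (auto simp: square_integrable_def)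
  moreover have "(\<lambda>x. (f x)\<^sup>2 + (g x)\<^sup>2 + 2 * (f x * g x)) = (\<lambda>x. (f x + g x)\<^sup>2)"
    by (simp add: power2_sum algebra_simps)
  ultimately show ?thesis
    using assms by (auto simp: square_integrable_def)
qed

lemma square_integrable_scale:
  assumes "square_integrable M f"
  shows "square_integrable M (\<lambda>x. c * f x)"
  using assms by (auto simp: square_integrable_def power_mult_distrib)

lemma square_integrable_diff:
  assumes "square_integrable M f" "square_integrable M g"
  shows "square_integrable M (\<lambda>x. f x - g x)"
  using square_integrable_add[OF assms(1) square_integrable_scale[OF assms(2), of "-1"]] by simp

lemma square_integrable_lincomb:
  assumes "\<And>i. i \<in> I \<Longrightarrow> square_integrable M (e i)"
  shows "square_integrable M (\<lambda>x. \<Sum>i\<in>I. c i * e i x)"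
  using assms
proof (induction I rule: infinite_finite_induct)
  case (insert i I)
  then show ?case
    by (simp add: square_integrable_add square_integrable_scale)
qed (simp_all add: square_integrable_def)

lemma L2_inner_commute: "L2_inner M f g = L2_inner M g f"
  by (simp add: L2_inner_def mult.commute)

lemma L2_inner_self_nonneg: "0 \<le> L2_inner M f f"
  by (simp add: L2_inner_def)

lemma L2_inner_diff_left:
  assumes "square_integrable M f" "square_integrable M g" "square_integrable M h"
  shows "L2_inner M (\<lambda>x. f x - g x) h = L2_inner M f h - L2_inner M g h"
  unfolding L2_inner_def
  using assms by (simp add: left_diff_distrib square_integrable_mult_integrable)

lemma L2_inner_diff_right:
  assumes "square_integrable M f" "square_integrable M g" "square_integrable M h"
  shows "L2_inner M h (\<lambda>x. f x - g x) = L2_inner M h f - L2_inner M h g"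
  using L2_inner_diff_left[OF assms] by (simp add: L2_inner_commute)

lemma L2_inner_lincomb_left:
  assumes "\<And>i. i \<in> I \<Longrightarrow> square_integrable M (e i)" "square_integrable M g"
  shows "L2_inner M (\<lambda>x. \<Sum>i\<in>I. c i * e i x) g = (\<Sum>i\<in>I. c i * L2_inner M (e i) g)"
proof -
  have "L2_inner M (\<lambda>x. \<Sum>i\<in>I. c i * e i x) g = (\<integral>x. (\<Sum>i\<in>I. c i * (e i x * g x)) \<partial>M)"
    unfolding L2_inner_def by (simp add: sum_distrib_right mult.assoc)
  also have "\<dots> = (\<Sum>i\<in>I. (\<integral>x. c i * (e i x * g x) \<partial>M))"
    using assms by (intro Bochner_Integration.integral_sum integrable_mult_right
        square_integrable_mult_integrable)
  finally show ?thesis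
    by (simp add: L2_inner_def)
qed

lemma L2_inner_lincomb_right:
  assumes "\<And>i. i \<in> I \<Longrightarrow> square_integrable M (e i)" "square_integrable M g"
  shows "L2_inner M g (\<lambda>x. \<Sum>i\<in>I. c i * e i x) = (\<Sum>i\<in>I. c i * L2_inner M g (e i))"
  using L2_inner_lincomb_left[OF assms] by (simp add: L2_inner_commute)

text \<open>
  The quadratic polynomial \<open>t \<mapsto> \<parallel>a - t b\<parallel>\<^sup>2\<close> is nonnegative; its minimiser gives the bound when
  \<open>\<parallel>b\<parallel> \<noteq> 0\<close>. If \<open>\<parallel>b\<parallel> = 0\<close>, the polynomial is affine and can be nonnegative only if its slope vanishes.
\<close>

lemma L2_Cauchy_Schwarz:
  assumes a: "square_integrable M a" and b: "square_integrable M b"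
  shows "(L2_inner M a b)\<^sup>2 \<le> L2_inner M a a * L2_inner M b b"
proof -
  have quad: "0 \<le> L2_inner M a a - 2 * t * L2_inner M a b + t\<^sup>2 * L2_inner M b b" for t
  proof -
    note tb = square_integrable_scale[OF b, of t]
    have scale: "L2_inner M f (\<lambda>x. t * b x) = t * L2_inner M f b"
      if "square_integrable M f" for f
      using L2_inner_lincomb_right[of "{()}" M "\<lambda>_. b" f "\<lambda>_. t"] b that by simp
    have "L2_inner M (\<lambda>x. a x - t * b x) (\<lambda>x. a x - t * b x)
        = L2_inner M a a - t * L2_inner M a b
          - (t * L2_inner M b a - t * (t * L2_inner M b b))"
      using a b tb scale[OF a] scale[OF b] scale[OF tb] L2_inner_commute[of M "\<lambda>x. t * b x" a]
        L2_inner_commute[of M "\<lambda>x. t * b x" b] L2_inner_commute[of M b a]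
      by (simp add: L2_inner_diff_left L2_inner_diff_right square_integrable_diff)
    then show ?thesis
      using L2_inner_self_nonneg[of M "\<lambda>x. a x - t * b x"]
      by (simp add: L2_inner_commute[of M b a] power2_eq_square algebra_simps)
  qed
  show ?thesis
  proof (cases "L2_inner M b b = 0")
    case True
    have "L2_inner M a b = 0"
    proof (rule ccontr)
      assume "L2_inner M a b \<noteq> 0"
      \<comment> \<open>At this \<open>t\<close> the affine function takes the value \<open>-1\<close>.\<close>
      then show False
        using quad[of "(L2_inner M a a + 1) / (2 * L2_inner M a b)"] True by simp
    qed
    then show ?thesis using True by simp
  next
    case False
    then have pos: "L2_inner M b b > 0" using L2_inner_self_nonneg[of M b] by simp
    show ?thesis
      using quad[of "L2_inner M a b / L2_inner M b b"] pos
      by (simp add: power2_eq_square field_simps)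
  qed
qed

text \<open>
  This expansion serves twice: with the Fourier coefficients of \<open>f\<close> it gives Bessel's inequality,
  and with \<open>f = 0\<close> it gives the norm of a linear combination.
\<close>

lemma L2_norm_diff_lincomb:
  assumes fin: "finite I" and f: "square_integrable M f"
    and e: "\<And>i. i \<in> I \<Longrightarrow> square_integrable M (e i)"
    and orth: "\<And>i j. i \<in> I \<Longrightarrow> j \<in> I \<Longrightarrow> L2_inner M (e i) (e j) = (if i = j then 1 else 0)"
  shows "L2_inner M (\<lambda>x. f x - (\<Sum>i\<in>I. c i * e i x)) (\<lambda>x. f x - (\<Sum>i\<in>I. c i * e i x))
       = L2_inner M f f - 2 * (\<Sum>i\<in>I. c i * L2_inner M f (e i)) + (\<Sum>i\<in>I. (c i)\<^sup>2)"
proof -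
  let ?g = "\<lambda>x. \<Sum>i\<in>I. c i * e i x"
  have g: "square_integrable M ?g" using e by (rule square_integrable_lincomb)
  have "L2_inner M ?g ?g = (\<Sum>i\<in>I. c i * (\<Sum>j\<in>I. c j * L2_inner M (e i) (e j)))"
    using e g by (simp add: L2_inner_lincomb_left L2_inner_lincomb_right)
  also have "\<dots> = (\<Sum>i\<in>I. (c i)\<^sup>2)"
    using fin by (intro sum.cong refl) (simp add: orth power2_eq_square if_distrib cong: if_cong sum.cong)
  finally have gg: "L2_inner M ?g ?g = (\<Sum>i\<in>I. (c i)\<^sup>2)" .
  have fg: "L2_inner M f ?g = (\<Sum>i\<in>I. c i * L2_inner M f (e i))"
    using e f by (rule L2_inner_lincomb_right)
  show ?thesis
    using f g gg fg L2_inner_commute[of M ?g f]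
    by (simp add: L2_inner_diff_left L2_inner_diff_right square_integrable_diff)
qed

lemma L2_norm_lincomb:
  assumes "finite I" "\<And>i. i \<in> I \<Longrightarrow> square_integrable M (e i)"
    and "\<And>i j. i \<in> I \<Longrightarrow> j \<in> I \<Longrightarrow> L2_inner M (e i) (e j) = (if i = j then 1 else 0)"
  shows "L2_inner M (\<lambda>x. \<Sum>i\<in>I. c i * e i x) (\<lambda>x. \<Sum>i\<in>I. c i * e i x) = (\<Sum>i\<in>I. (c i)\<^sup>2)"
proof -
  have "square_integrable M (\<lambda>_. 0)" by (simp add: square_integrable_def)
  from L2_norm_diff_lincomb[OF assms(1) this assms(2,3), of c]
  show ?thesis by (simp add: L2_inner_def)
qed

lemma Bessel_inequality:
  assumes e: "orthonormal_system M e" and f: "square_integrable M f"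
  shows "(\<Sum>i=1..k. (L2_inner M f (e i))\<^sup>2) \<le> L2_inner M f f"
proof -
  let ?g = "\<lambda>x. f x - (\<Sum>i=1..k. L2_inner M f (e i) * e i x)"
  have "L2_inner M ?g ?g = L2_inner M f f - 2 * (\<Sum>i=1..k. L2_inner M f (e i) * L2_inner M f (e i))
      + (\<Sum>i=1..k. (L2_inner M f (e i))\<^sup>2)"
    using e f by (intro L2_norm_diff_lincomb) (auto simp: orthonormal_system_def)
  then show ?thesis
    using L2_inner_self_nonneg[of M ?g] by (simp add: power2_eq_square)
qed

section \<open>Singular values of a matrix\<close>

text \<open>
  Real functions of two indices replace matrices here, so that the coordinate vectors can be
  used directly as coefficients of finite sums of basis functions.
\<close>

definition orthonormal_columns :: "nat \<Rightarrow> (nat \<Rightarrow> nat \<Rightarrow> real) \<Rightarrow> bool" where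
  "orthonormal_columns n U \<longleftrightarrow>
     (\<forall>k<n. \<forall>l<n. (\<Sum>i<n. U i k * U i l) = (if k = l then 1 else 0))"

lemma singular_values_entries:
  assumes "singular_values n A sv"
  obtains U V :: "nat \<Rightarrow> nat \<Rightarrow> real"
  where "orthonormal_columns n U" "orthonormal_columns n V"
    "\<forall>i<n. \<forall>j<n. A $$ (i, j) = (\<Sum>k<n. (U i k * sv (Suc k)) * V j k)"
proof -
  have columns: "orthonormal_columns n (\<lambda>i k. W $$ (i, k))" if W: "real_orthogonal_mat n W" for W
    unfolding orthonormal_columns_def
  proof (intro allI impI)
    fix k l assume kl: "k < n" "l < n"
    have carr: "W \<in> carrier_mat n n" and one: "transpose_mat W * W = 1\<^sub>m n"
      using W by (auto simp: real_orthogonal_mat_def)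
    have "(transpose_mat W * W) $$ (k, l) = (\<Sum>i<n. W $$ (i, k) * W $$ (i, l))"
      using carr kl by (auto simp: scalar_prod_def atLeast0LessThan)
    then show "(\<Sum>i<n. W $$ (i, k) * W $$ (i, l)) = (if k = l then 1 else 0)"
      using one kl by simp
  qed
  obtain U V where UV: "real_orthogonal_mat n U" "real_orthogonal_mat n V"
    and A: "A = U * mat_diag n (\<lambda>k. sv (Suc k)) * transpose_mat V"
    using assms by (auto simp: singular_values_def)
  have carr: "U \<in> carrier_mat n n" "V \<in> carrier_mat n n"
    using UV by (auto simp: real_orthogonal_mat_def)
  have "A $$ (i, j) = (\<Sum>k<n. (U $$ (i, k) * sv (Suc k)) * V $$ (j, k))" if "i < n" "j < n" for i j
    unfolding A mat_diag_mult_right[OF carr(1)]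
    using carr that by (auto simp: scalar_prod_def atLeast0LessThan)
  with columns[OF UV(1)] columns[OF UV(2)] show ?thesis
    by (intro that[of "\<lambda>i k. U $$ (i, k)" "\<lambda>j k. V $$ (j, k)"]) auto
qed

lemma orthonormal_columns_inner:
  assumes "orthonormal_columns n U"
  shows "(\<Sum>i<n. (\<Sum>k<n. a k * U i k) * (\<Sum>l<n. b l * U i l)) = (\<Sum>k<n. a k * b k)"
proof -
  have "(\<Sum>i<n. (\<Sum>k<n. a k * U i k) * (\<Sum>l<n. b l * U i l))
      = (\<Sum>i<n. \<Sum>k<n. \<Sum>l<n. a k * b l * (U i k * U i l))"
    by (simp add: sum_product algebra_simps)
  also have "\<dots> = (\<Sum>k<n. \<Sum>i<n. \<Sum>l<n. a k * b l * (U i k * U i l))"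
    by (rule sum.swap)
  also have "\<dots> = (\<Sum>k<n. \<Sum>l<n. \<Sum>i<n. a k * b l * (U i k * U i l))"
    by (intro sum.cong refl sum.swap)
  also have "\<dots> = (\<Sum>k<n. \<Sum>l<n. a k * b l * (if k = l then 1 else 0))"
    using assms by (intro sum.cong refl) (simp add: orthonormal_columns_def flip: sum_distrib_left)
  also have "\<dots> = (\<Sum>k<n. a k * b k)"
    by (simp add: if_distrib cong: if_cong)
  finally show ?thesis .
qed

lemma frobenius_norm_sq_singular_values:
  assumes A: "A \<in> carrier_mat n n" and sv: "singular_values n A sv"
  shows "(frobenius_norm A)\<^sup>2 = (\<Sum>k<n. (sv (Suc k))\<^sup>2)"
proof -
  obtain U V :: "nat \<Rightarrow> nat \<Rightarrow> real"
    where U: "orthonormal_columns n U" and V: "orthonormal_columns n V"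
    and entries: "\<forall>i<n. \<forall>j<n. A $$ (i, j) = (\<Sum>k<n. (U i k * sv (Suc k)) * V j k)"
    by (rule singular_values_entries[OF sv])
  have "(frobenius_norm A)\<^sup>2 = (\<Sum>i<n. \<Sum>j<n. (A $$ (i, j))\<^sup>2)"
    using A by (simp add: frobenius_norm_def sum_nonneg)
  also have "\<dots> = (\<Sum>i<n. \<Sum>k<n. (U i k * sv (Suc k)) * (U i k * sv (Suc k)))"
  proof (rule sum.cong[OF refl])
    fix i assume "i \<in> {..<n}"
    then have "(\<Sum>j<n. (A $$ (i, j))\<^sup>2)
        = (\<Sum>j<n. (\<Sum>k<n. (U i k * sv (Suc k)) * V j k) * (\<Sum>k<n. (U i k * sv (Suc k)) * V j k))"
      by (simp add: entries power2_eq_square)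
    also have "\<dots> = (\<Sum>k<n. (U i k * sv (Suc k)) * (U i k * sv (Suc k)))"
      using V by (rule orthonormal_columns_inner)
    finally show "(\<Sum>j<n. (A $$ (i, j))\<^sup>2) = \<dots>" .
  qed
  also have "\<dots> = (\<Sum>k<n. \<Sum>i<n. (sv (Suc k))\<^sup>2 * (U i k * U i k))"
    by (subst sum.swap) (simp add: power2_eq_square algebra_simps)
  also have "\<dots> = (\<Sum>k<n. (sv (Suc k))\<^sup>2)"
    using U by (simp add: orthonormal_columns_def flip: sum_distrib_left)
  finally show ?thesis .
qed

text \<open>
  Completing the \<open>p\<close> equations in \<open>p + 1\<close> unknowns by a zero row makes a singular square matrix.
\<close>

lemma underdetermined_homogeneous_system:
  fixes a :: "nat \<Rightarrow> nat \<Rightarrow> real"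
  obtains c where "\<exists>l\<le>p. c l \<noteq> 0" "\<forall>r<p. (\<Sum>l\<le>p. c l * a r l) = 0"
proof -
  define B where "B = mat\<^sub>r (Suc p) (Suc p)
    (\<lambda>r. if r = p then 0\<^sub>v (Suc p) else Matrix.vec (Suc p) (a r))"
  have B: "B \<in> carrier_mat (Suc p) (Suc p)" by (simp add: B_def)
  have "Determinant.det B = 0"
    unfolding B_def by (rule det_row_0) auto
  then obtain w where w: "w \<in> carrier_vec (Suc p)" "w \<noteq> 0\<^sub>v (Suc p)" "B *\<^sub>v w = 0\<^sub>v (Suc p)"
    using det_0_iff_vec_prod_zero[OF B] by blast
  show ?thesis
  proof (rule that[of "vec_index w"])
    show "\<exists>l\<le>p. vec_index w l \<noteq> 0"
    proof (rule ccontr)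
      assume "\<not> ?thesis"
      then have "w = 0\<^sub>v (Suc p)" using w(1) by (intro eq_vecI) auto
      with w(2) show False by simp
    qed
    have "(\<Sum>l\<le>p. vec_index w l * a r l) = 0" if r: "r < p" for r
    proof -
      have "vec_index (B *\<^sub>v w) r = (\<Sum>l<Suc p. a r l * vec_index w l)"
        using w(1) r by (auto simp: B_def scalar_prod_def atLeast0LessThan)
      then show ?thesis
        using w(3) r by (simp add: lessThan_Suc_atMost mult.commute)
    qed
    then show "\<forall>r<p. (\<Sum>l\<le>p. vec_index w l * a r l) = 0" by blast
  qed
qed

text \<open>
  The matrix half of the minimax argument. Both test vectors have the same coordinates \<open>c\<close> with
  respect to the first \<open>p + 1\<close> left and right singular vectors, so the bilinear form becomes
  \<open>\<Sum> c\<^sub>k\<^sup>2 \<sigma>\<^sub>k\<close>, where each \<open>\<sigma>\<^sub>k\<close> that occurs is at least \<open>sv (Suc p)\<close>. The \<open>p\<close> linear constraints \<open>w\<close> leave room for a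
  nonzero \<open>c\<close>; they will express orthogonality to the first \<open>p\<close> right singular functions.
\<close>

lemma singular_value_test_vectors:
  fixes w :: "nat \<Rightarrow> nat \<Rightarrow> real"
  assumes sv: "singular_values n A sv" and p: "p < n"
  obtains x y S where "S > 0" "(\<Sum>i<n. (x i)\<^sup>2) = S" "(\<Sum>j<n. (y j)\<^sup>2) = S"
    "\<forall>r<p. (\<Sum>j<n. y j * w r j) = 0"
    "S * sv (Suc p) \<le> (\<Sum>i<n. x i * (\<Sum>j<n. y j * A $$ (i, j)))"
proof -
  obtain U V :: "nat \<Rightarrow> nat \<Rightarrow> real"
    where U: "orthonormal_columns n U" and V: "orthonormal_columns n V"
    and entries: "\<forall>i<n. \<forall>j<n. A $$ (i, j) = (\<Sum>k<n. (U i k * sv (Suc k)) * V j k)"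
    by (rule singular_values_entries[OF sv])
  obtain c0 where c0: "\<exists>l\<le>p. c0 l \<noteq> 0"
      "\<forall>r<p. (\<Sum>l\<le>p. c0 l * (\<Sum>j<n. V j l * w r j)) = 0"
    by (rule underdetermined_homogeneous_system[of p "\<lambda>r l. \<Sum>j<n. V j l * w r j"])
  define c where "c l = (if l \<le> p then c0 l else 0)" for l
  define x where "x i = (\<Sum>k<n. c k * U i k)" for i
  define y where "y j = (\<Sum>k<n. c k * V j k)" for j
  define S where "S = (\<Sum>k<n. (c k)\<^sup>2)"
  show ?thesis
  proof (rule that[of S x y])
    show "S > 0"
    proof -
      obtain l where "l \<le> p" "c0 l \<noteq> 0" using c0(1) by blast
      then have "0 < (c l)\<^sup>2" "l < n" using p by (auto simp: c_def)
      then show ?thesis unfolding S_def by (intro sum_pos2[of _ l]) auto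
    qed
    show "(\<Sum>i<n. (x i)\<^sup>2) = S"
      using orthonormal_columns_inner[OF U, of c c] by (simp add: x_def S_def power2_eq_square)
    show "(\<Sum>j<n. (y j)\<^sup>2) = S"
      using orthonormal_columns_inner[OF V, of c c] by (simp add: y_def S_def power2_eq_square)
    have "(\<Sum>j<n. y j * w r j) = 0" if "r < p" for r
    proof -
      have "(\<Sum>j<n. y j * w r j) = (\<Sum>k<n. c k * (\<Sum>j<n. V j k * w r j))"
        unfolding y_def sum_distrib_right sum_distrib_left
        by (subst sum.swap) (simp add: mult.assoc)
      also have "\<dots> = (\<Sum>k\<le>p. c0 k * (\<Sum>j<n. V j k * w r j))"
        using p by (intro sum.mono_neutral_cong_right) (auto simp: c_def)
      finally show ?thesis using c0(2) that by simp
    qed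
    then show "\<forall>r<p. (\<Sum>j<n. y j * w r j) = 0" by blast
    have Ay: "(\<Sum>j<n. y j * A $$ (i, j)) = (\<Sum>k<n. (c k * sv (Suc k)) * U i k)" if "i < n" for i
    proof -
      have "(\<Sum>j<n. y j * A $$ (i, j))
          = (\<Sum>j<n. (\<Sum>k<n. c k * V j k) * (\<Sum>k<n. (U i k * sv (Suc k)) * V j k))"
        using that by (simp add: entries y_def)
      also have "\<dots> = (\<Sum>k<n. c k * (U i k * sv (Suc k)))"
        using V by (rule orthonormal_columns_inner)
      finally show ?thesis by (simp add: mult_ac)
    qed
    have "(\<Sum>i<n. x i * (\<Sum>j<n. y j * A $$ (i, j)))
        = (\<Sum>i<n. x i * (\<Sum>k<n. (c k * sv (Suc k)) * U i k))"
      by (simp add: Ay)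
    also have "\<dots> = (\<Sum>k<n. c k * (c k * sv (Suc k)))"
      unfolding x_def using U by (rule orthonormal_columns_inner)
    also have "\<dots> \<ge> (\<Sum>k<n. (c k)\<^sup>2 * sv (Suc p))"
    proof (rule sum_mono)
      fix k assume k: "k \<in> {..<n}"
      show "(c k)\<^sup>2 * sv (Suc p) \<le> c k * (c k * sv (Suc k))"
      proof (cases "k \<le> p")
        case True
        then have "sv (Suc p) \<le> sv (Suc k)"
          using sv p k by (auto simp: singular_values_def)
        then show ?thesis
          by (simp add: power2_eq_square mult_left_mono flip: mult.assoc)
      qed (simp add: c_def)
    qed
    finally show "S * sv (Suc p) \<le> (\<Sum>i<n. x i * (\<Sum>j<n. y j * A $$ (i, j)))"
      by (simp add: S_def sum_distrib_right)
  qed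
qed

section \<open>Kernels as bilinear forms\<close>

definition tensor :: "('a \<Rightarrow> real) \<Rightarrow> ('b \<Rightarrow> real) \<Rightarrow> 'a \<times> 'b \<Rightarrow> real" where
  "tensor f g = (\<lambda>(s, t). f s * g t)"

lemma tensor_lincomb_left: "tensor (\<lambda>s. \<Sum>i\<in>I. c i * e i s) g = (\<lambda>z. \<Sum>i\<in>I. c i * tensor (e i) g z)"
  by (auto simp: tensor_def sum_distrib_right mult.assoc)

lemma tensor_lincomb_right: "tensor f (\<lambda>t. \<Sum>i\<in>I. c i * e i t) = (\<lambda>z. \<Sum>i\<in>I. c i * tensor f (e i) z)"
  by (auto simp: tensor_def sum_distrib_left mult_ac)

context pair_sigma_finite
begin

lemma integrable_tensor:
  fixes f :: "'a \<Rightarrow> real" and g :: "'b \<Rightarrow> real"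
  assumes f: "integrable M1 f" and g: "integrable M2 g"
  shows "integrable (M1 \<Otimes>\<^sub>M M2) (\<lambda>(s, t). f s * g t)"
proof (rule Fubini_integrable)
  show "(\<lambda>(s, t). f s * g t) \<in> borel_measurable (M1 \<Otimes>\<^sub>M M2)"
    using borel_measurable_integrable[OF f] borel_measurable_integrable[OF g] by measurable
  have "(\<lambda>s. \<integral>t. norm (f s * g t) \<partial>M2) = (\<lambda>s. \<bar>f s\<bar> * (\<integral>t. \<bar>g t\<bar> \<partial>M2))"
    by (simp add: abs_mult)
  then show "integrable M1 (\<lambda>s. \<integral>t. norm (case (s, t) of (s, t) \<Rightarrow> f s * g t) \<partial>M2)"
    using f by simp
  show "AE s in M1. integrable M2 (\<lambda>t. case (s, t) of (s, t) \<Rightarrow> f s * g t)"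
    using g by simp
qed

lemma square_integrable_tensor:
  assumes f: "square_integrable M1 f" and g: "square_integrable M2 g"
  shows "square_integrable (M1 \<Otimes>\<^sub>M M2) (tensor f g)"
  unfolding square_integrable_def
proof
  have [measurable]: "f \<in> borel_measurable M1" "g \<in> borel_measurable M2"
    using f g by (auto simp: square_integrable_def)
  show "tensor f g \<in> borel_measurable (M1 \<Otimes>\<^sub>M M2)"
    unfolding tensor_def by measurable
  have "(\<lambda>z. (tensor f g z)\<^sup>2) = (\<lambda>(s, t). (f s)\<^sup>2 * (g t)\<^sup>2)"
    by (auto simp: tensor_def power_mult_distrib)
  then show "integrable (M1 \<Otimes>\<^sub>M M2) (\<lambda>z. (tensor f g z)\<^sup>2)"
    using integrable_tensor[of "\<lambda>s. (f s)\<^sup>2" "\<lambda>t. (g t)\<^sup>2"] f g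
    by (auto simp: square_integrable_def)
qed

lemma L2_inner_iterated:
  assumes "square_integrable (M1 \<Otimes>\<^sub>M M2) F" "square_integrable (M1 \<Otimes>\<^sub>M M2) G"
  shows "L2_inner (M1 \<Otimes>\<^sub>M M2) F G = (\<integral>s. (\<integral>t. F (s, t) * G (s, t) \<partial>M2) \<partial>M1)"
  unfolding L2_inner_def
  using integral_fst'[OF square_integrable_mult_integrable[OF assms]] by simp

lemma L2_inner_tensor:
  assumes "square_integrable M1 f" "square_integrable M1 f'"
    and "square_integrable M2 g" "square_integrable M2 g'"
  shows "L2_inner (M1 \<Otimes>\<^sub>M M2) (tensor f g) (tensor f' g') = L2_inner M1 f f' * L2_inner M2 g g'"
proof -
  have "(\<integral>t. tensor f g (s, t) * tensor f' g' (s, t) \<partial>M2) = (f s * f' s) * L2_inner M2 g g'" for s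
  proof -
    have "(\<lambda>t. tensor f g (s, t) * tensor f' g' (s, t)) = (\<lambda>t. (f s * f' s) * (g t * g' t))"
      by (simp add: tensor_def mult_ac)
    then show ?thesis by (simp only: L2_inner_def integral_mult_right_zero)
  qed
  then show ?thesis
    using assms by (simp add: L2_inner_iterated square_integrable_tensor)
      (simp add: L2_inner_def[of M1])
qed

lemma orthonormal_system_tensor:
  assumes "orthonormal_system M1 u" "orthonormal_system M2 v"
  shows "orthonormal_system (M1 \<Otimes>\<^sub>M M2) (\<lambda>i. tensor (u i) (v i))"
  using assms by (auto simp: orthonormal_system_def square_integrable_tensor L2_inner_tensor)

lemma kernel_norm_sq_eq:
  assumes "square_integrable (M1 \<Otimes>\<^sub>M M2) (\<lambda>(s, t). K s t)"
  shows "kernel_norm_sq M1 M2 K = L2_inner (M1 \<Otimes>\<^sub>M M2) (\<lambda>(s, t). K s t) (\<lambda>(s, t). K s t)"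
  using L2_inner_iterated[OF assms assms] by (simp add: kernel_norm_sq_def power2_eq_square)

text \<open>
  Convergence of the expansion in mean becomes convergence of bilinear forms when the remainder is paired
  with \<open>f \<otimes> g\<close>, by the Cauchy-Schwarz inequality on the product space.
\<close>

lemma singular_value_expansion_bilinear:
  assumes H: "square_integrable_kernel M1 M2 H"
    and sve: "singular_value_expansion M1 M2 H \<mu> u v"
    and f: "square_integrable M1 f" and g: "square_integrable M2 g"
  shows "(\<lambda>k. \<Sum>i=1..k. \<mu> i * (L2_inner M1 f (u i) * L2_inner M2 g (v i)))
           \<longlonglongrightarrow> L2_inner (M1 \<Otimes>\<^sub>M M2) (\<lambda>(s, t). H s t) (tensor f g)"
proof -
  let ?N = "M1 \<Otimes>\<^sub>M M2"
  let ?h = "\<lambda>(s, t). H s t"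
  let ?w = "\<lambda>i. tensor (u i) (v i)"
  define R where "R k = (\<lambda>z. ?h z - (\<Sum>i=1..k. \<mu> i * ?w i z))" for k
  have h: "square_integrable ?N ?h" using H by (simp add: square_integrable_kernel_def)
  have uv: "square_integrable M1 (u i)" "square_integrable M2 (v i)" if "i \<ge> 1" for i
    using sve that by (auto simp: singular_value_expansion_def orthonormal_system_def)
  have w: "square_integrable ?N (?w i)" if "i \<in> {1..k}" for i k
    using that uv by (auto intro: square_integrable_tensor)
  have sum: "square_integrable ?N (\<lambda>z. \<Sum>i=1..k. \<mu> i * ?w i z)" for k
    using w by (rule square_integrable_lincomb)
  have R: "square_integrable ?N (R k)" for k
    unfolding R_def using h sum by (rule square_integrable_diff)
  have R_eq: "R k = (\<lambda>(s, t). H s t - (\<Sum>i=1..k. \<mu> i * u i s * v i t))" for k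
    by (auto simp: R_def tensor_def mult.assoc)
  have "L2_inner ?N (R k) (R k) = kernel_norm_sq M1 M2 (\<lambda>s t. H s t - (\<Sum>i=1..k. \<mu> i * u i s * v i t))" for k
    using kernel_norm_sq_eq[OF R[of k, unfolded R_eq]] by (simp add: R_eq)
  then have RR: "(\<lambda>k. L2_inner ?N (R k) (R k)) \<longlonglongrightarrow> 0"
    using sve by (simp add: singular_value_expansion_def)
  have t: "square_integrable ?N (tensor f g)" using f g by (rule square_integrable_tensor)
  have "(\<lambda>k. (L2_inner ?N (R k) (tensor f g))\<^sup>2) \<longlonglongrightarrow> 0"
  proof (rule tendsto_sandwich[OF _ _ tendsto_const])
    show "(\<lambda>k. L2_inner ?N (R k) (R k) * L2_inner ?N (tensor f g) (tensor f g)) \<longlonglongrightarrow> 0"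
      using tendsto_mult_left_zero[OF RR] .
  qed (auto intro: always_eventually L2_Cauchy_Schwarz R t)
  from tendsto_real_sqrt[OF this] have "(\<lambda>k. L2_inner ?N (R k) (tensor f g)) \<longlonglongrightarrow> 0"
    by (simp add: tendsto_rabs_zero_iff)
  moreover have "L2_inner ?N (R k) (tensor f g) = L2_inner ?N ?h (tensor f g)
      - (\<Sum>i=1..k. \<mu> i * (L2_inner M1 f (u i) * L2_inner M2 g (v i)))" for k
  proof -
    have "L2_inner ?N (R k) (tensor f g)
        = L2_inner ?N ?h (tensor f g) - L2_inner ?N (\<lambda>z. \<Sum>i=1..k. \<mu> i * ?w i z) (tensor f g)"
      unfolding R_def using h sum t by (rule L2_inner_diff_left)
    also have "L2_inner ?N (\<lambda>z. \<Sum>i=1..k. \<mu> i * ?w i z) (tensor f g)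
        = (\<Sum>i=1..k. \<mu> i * L2_inner ?N (?w i) (tensor f g))"
      using w t by (rule L2_inner_lincomb_left)
    also have "\<dots> = (\<Sum>i=1..k. \<mu> i * (L2_inner M1 f (u i) * L2_inner M2 g (v i)))"
      using uv f g by (intro sum.cong refl)
        (simp add: L2_inner_tensor L2_inner_commute[of _ "u _"] L2_inner_commute[of _ "v _"])
    finally show ?thesis .
  qed
  ultimately show ?thesis
    by (simp add: LIMSEQ_iff abs_minus_commute)
qed

text \<open>
  The products \<open>u\<^sub>i \<otimes> v\<^sub>i\<close> are orthonormal and the Fourier coefficients of \<open>H\<close> with respect to them are the
  singular values, so this is Bessel's inequality.
\<close>

lemma sum_singular_values_sq_le_norm_sq:
  assumes H: "square_integrable_kernel M1 M2 H"
    and sve: "singular_value_expansion M1 M2 H \<mu> u v"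
  shows "(\<Sum>i=1..k. (\<mu> i)\<^sup>2) \<le> kernel_norm_sq M1 M2 H"
proof -
  let ?N = "M1 \<Otimes>\<^sub>M M2"
  let ?h = "\<lambda>(s, t). H s t"
  have h: "square_integrable ?N ?h" using H by (simp add: square_integrable_kernel_def)
  have u: "orthonormal_system M1 u" and v: "orthonormal_system M2 v"
    using sve by (auto simp: singular_value_expansion_def)
  have coeff: "L2_inner ?N ?h (tensor (u j) (v j)) = \<mu> j" if j: "j \<ge> 1" for j
  proof (rule LIMSEQ_unique)
    show "(\<lambda>k. \<Sum>i=1..k. \<mu> i * (L2_inner M1 (u j) (u i) * L2_inner M2 (v j) (v i)))
           \<longlonglongrightarrow> L2_inner ?N ?h (tensor (u j) (v j))"
      using u v j by (intro singular_value_expansion_bilinear[OF H sve])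
        (auto simp: orthonormal_system_def)
    have "(\<Sum>i=1..k. \<mu> i * (L2_inner M1 (u j) (u i) * L2_inner M2 (v j) (v i))) = \<mu> j"
      if "k \<ge> j" for k
    proof -
      have "(\<Sum>i=1..k. \<mu> i * (L2_inner M1 (u j) (u i) * L2_inner M2 (v j) (v i)))
          = (\<Sum>i=1..k. if j = i then \<mu> i else 0)"
        using u v j by (intro sum.cong refl) (auto simp: orthonormal_system_def)
      then show ?thesis using that j by simp
    qed
    then show "(\<lambda>k. \<Sum>i=1..k. \<mu> i * (L2_inner M1 (u j) (u i) * L2_inner M2 (v j) (v i))) \<longlonglongrightarrow> \<mu> j"
      by (intro tendsto_eventually) (auto simp: eventually_sequentially)
  qed
  have "(\<Sum>i=1..k. (\<mu> i)\<^sup>2) = (\<Sum>i=1..k. (L2_inner ?N ?h (tensor (u i) (v i)))\<^sup>2)"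
    using coeff by (intro sum.cong) auto
  also have "\<dots> \<le> L2_inner ?N ?h ?h"
    using Bessel_inequality[OF orthonormal_system_tensor[OF u v] h] .
  finally show ?thesis by (simp add: kernel_norm_sq_eq[OF h])
qed

text \<open>
  The function half of the minimax argument. The first \<open>p\<close> terms of the expansion vanish, the
  other singular values are at most \<open>\<mu> (Suc p)\<close>, and the products of coefficients are bounded by
  \<open>a b \<le> (a\<^sup>2 + b\<^sup>2) / 2\<close> and Bessel's inequality. Because \<open>f\<close> and \<open>g\<close> have the same norm, this
  bound is as good as the one by the Cauchy-Schwarz inequality.
\<close>

lemma kernel_form_le_singular_value:
  assumes H: "square_integrable_kernel M1 M2 H"
    and sve: "singular_value_expansion M1 M2 H \<mu> u v"
    and f: "square_integrable M1 f" and g: "square_integrable M2 g"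
    and norms: "L2_inner M1 f f = S" "L2_inner M2 g g = S"
    and orth: "\<And>i. 1 \<le> i \<Longrightarrow> i \<le> p \<Longrightarrow> L2_inner M2 g (v i) = 0"
  shows "L2_inner (M1 \<Otimes>\<^sub>M M2) (\<lambda>(s, t). H s t) (tensor f g) \<le> S * \<mu> (Suc p)"
proof (rule LIMSEQ_le_const2[OF singular_value_expansion_bilinear[OF H sve f g]], intro exI allI impI)
  fix k :: nat
  let ?a = "\<lambda>i. L2_inner M1 f (u i)" and ?b = "\<lambda>i. L2_inner M2 g (v i)"
  have u: "orthonormal_system M1 u" and v: "orthonormal_system M2 v"
    and decr: "\<And>i. i \<ge> 1 \<Longrightarrow> \<mu> (Suc i) \<le> \<mu> i" and pos: "\<And>i. i \<ge> 1 \<Longrightarrow> \<mu> i > 0"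
    using sve by (auto simp: singular_value_expansion_def)
  have anti: "\<mu> j \<le> \<mu> i" if "1 \<le> i" "i \<le> j" for i j
    using that(2,1) by (induction j rule: dec_induct) (use decr order.trans in force)+
  have bound: "\<mu> i * (?a i * ?b i) \<le> \<mu> (Suc p) * (((?a i)\<^sup>2 + (?b i)\<^sup>2) / 2)"
    if i: "i \<in> {1..k}" for i
  proof (cases "i \<le> p")
    case True
    then show ?thesis using orth[of i] i pos[of "Suc p"] by simp
  next
    case False
    have "0 \<le> (?a i - ?b i)\<^sup>2" by simp
    then have "?a i * ?b i \<le> ((?a i)\<^sup>2 + (?b i)\<^sup>2) / 2" by (simp add: power2_diff)
    then have "\<mu> i * (?a i * ?b i) \<le> \<mu> i * (((?a i)\<^sup>2 + (?b i)\<^sup>2) / 2)"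
      using pos[of i] i by (intro mult_left_mono) auto
    also have "\<dots> \<le> \<mu> (Suc p) * (((?a i)\<^sup>2 + (?b i)\<^sup>2) / 2)"
      using anti[of "Suc p" i] False by (intro mult_right_mono) auto
    finally show ?thesis .
  qed
  have "(\<Sum>i=1..k. \<mu> i * (?a i * ?b i)) \<le> (\<Sum>i=1..k. \<mu> (Suc p) * (((?a i)\<^sup>2 + (?b i)\<^sup>2) / 2))"
    using bound by (rule sum_mono)
  also have "\<dots> = \<mu> (Suc p) * (((\<Sum>i=1..k. (?a i)\<^sup>2) + (\<Sum>i=1..k. (?b i)\<^sup>2)) / 2)"
    by (simp add: sum.distrib flip: sum_distrib_left sum_divide_distrib)
  also have "\<dots> \<le> \<mu> (Suc p) * ((S + S) / 2)"
    using Bessel_inequality[OF u f, of k] Bessel_inequality[OF v g, of k] norms pos[of "Suc p"]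
    by (intro mult_left_mono divide_right_mono add_mono) auto
  finally show "(\<Sum>i=1..k. \<mu> i * (?a i * ?b i)) \<le> S * \<mu> (Suc p)"
    by (simp add: mult.commute)
qed

end

section \<open>Galerkin singular values compared with those of the kernel\<close>

context pair_sigma_finite
begin

lemma galerkin_matrix_entry:
  assumes H: "square_integrable_kernel M1 M2 H"
    and "square_integrable M1 (\<psi> (Suc i))" "square_integrable M2 (\<phi> (Suc j))" "i < n" "j < n"
  shows "galerkin_matrix M1 M2 H \<psi> \<phi> n $$ (i, j)
       = L2_inner (M1 \<Otimes>\<^sub>M M2) (\<lambda>(s, t). H s t) (tensor (\<psi> (Suc i)) (\<phi> (Suc j)))"
  using assms by (subst L2_inner_iterated)
    (simp_all add: square_integrable_kernel_def square_integrable_tensor,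
      simp add: galerkin_matrix_def tensor_def mult_ac)

text \<open>
  The test vectors of the matrix, used as coefficients of basis functions, become test functions for
  the kernel with the same norms and the same value of the bilinear form.
\<close>

theorem galerkin_singular_value_le:
  assumes H: "square_integrable_kernel M1 M2 H"
    and sve: "singular_value_expansion M1 M2 H \<mu> u v"
    and \<psi>: "orthonormal_system M1 \<psi>" and \<phi>: "orthonormal_system M2 \<phi>"
    and sv: "singular_values n (galerkin_matrix M1 M2 H \<psi> \<phi> n) \<sigma>"
    and p: "p < n"
  shows "\<sigma> (Suc p) \<le> \<mu> (Suc p)"
proof -
  let ?N = "M1 \<Otimes>\<^sub>M M2"
  let ?h = "\<lambda>(s, t). H s t"
  let ?A = "galerkin_matrix M1 M2 H \<psi> \<phi> n"
  have sq\<psi>: "square_integrable M1 (\<psi> (Suc i))" and sq\<phi>: "square_integrable M2 (\<phi> (Suc i))" for i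
    using \<psi> \<phi> by (auto simp: orthonormal_system_def)
  have sqv: "square_integrable M2 (v (Suc r))" for r
    using sve by (auto simp: singular_value_expansion_def orthonormal_system_def)
  have h: "square_integrable ?N ?h" using H by (simp add: square_integrable_kernel_def)
  obtain x y S where S: "S > 0" and x: "(\<Sum>i<n. (x i)\<^sup>2) = S" and y: "(\<Sum>j<n. (y j)\<^sup>2) = S"
    and orth: "\<forall>r<p. (\<Sum>j<n. y j * L2_inner M2 (\<phi> (Suc j)) (v (Suc r))) = 0"
    and le: "S * \<sigma> (Suc p) \<le> (\<Sum>i<n. x i * (\<Sum>j<n. y j * ?A $$ (i, j)))"
    by (rule singular_value_test_vectors[OF sv p, of "\<lambda>r j. L2_inner M2 (\<phi> (Suc j)) (v (Suc r))"])
  define f where "f = (\<lambda>s. \<Sum>i<n. x i * \<psi> (Suc i) s)"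
  define g where "g = (\<lambda>t. \<Sum>j<n. y j * \<phi> (Suc j) t)"
  have f: "square_integrable M1 f" unfolding f_def using sq\<psi> by (rule square_integrable_lincomb)
  have g: "square_integrable M2 g" unfolding g_def using sq\<phi> by (rule square_integrable_lincomb)
  have ff: "L2_inner M1 f f = S"
    unfolding f_def x[symmetric] using \<psi> sq\<psi>
    by (intro L2_norm_lincomb) (auto simp: orthonormal_system_def)
  have gg: "L2_inner M2 g g = S"
    unfolding g_def y[symmetric] using \<phi> sq\<phi>
    by (intro L2_norm_lincomb) (auto simp: orthonormal_system_def)
  have gv: "L2_inner M2 g (v i) = 0" if "1 \<le> i" "i \<le> p" for i
  proof -
    obtain r where r: "i = Suc r" using \<open>1 \<le> i\<close> by (cases i) auto
    with that have "r < p" by simp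
    then show ?thesis
      unfolding g_def r using \<open>r < p\<close> orth sq\<phi> sqv by (subst L2_inner_lincomb_left) auto
  qed
  have inner: "L2_inner ?N ?h (tensor (\<psi> (Suc i)) g) = (\<Sum>j<n. y j * ?A $$ (i, j))"
    if "i < n" for i
  proof -
    have "L2_inner ?N ?h (tensor (\<psi> (Suc i)) g)
        = (\<Sum>j<n. y j * L2_inner ?N ?h (tensor (\<psi> (Suc i)) (\<phi> (Suc j))))"
      unfolding g_def tensor_lincomb_right using sq\<psi> sq\<phi> h
      by (intro L2_inner_lincomb_right square_integrable_tensor)
    then show ?thesis using H sq\<psi> sq\<phi> that by (simp add: galerkin_matrix_entry)
  qed
  have "L2_inner ?N ?h (tensor f g) = (\<Sum>i<n. x i * L2_inner ?N ?h (tensor (\<psi> (Suc i)) g))"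
    unfolding f_def tensor_lincomb_left using sq\<psi> g h
    by (intro L2_inner_lincomb_right square_integrable_tensor)
  also have "\<dots> = (\<Sum>i<n. x i * (\<Sum>j<n. y j * ?A $$ (i, j)))"
    by (simp add: inner)
  finally have "S * \<sigma> (Suc p) \<le> L2_inner ?N ?h (tensor f g)"
    using le by simp
  also have "\<dots> \<le> S * \<mu> (Suc p)"
    using kernel_form_le_singular_value[OF H sve f g ff gg gv] .
  finally show ?thesis using S by simp
qed

text \<open>
  A single term of the sum of the nonnegative differences \<open>\<mu>\<^sub>i\<^sup>2 - \<sigma>\<^sub>i\<^sup>2\<close> is at most the whole sum, which
  the defect dominates.
\<close>

theorem galerkin_singular_value_defect:
  assumes H: "square_integrable_kernel M1 M2 H"
    and sve: "singular_value_expansion M1 M2 H \<mu> u v"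
    and \<psi>: "orthonormal_system M1 \<psi>" and \<phi>: "orthonormal_system M2 \<phi>"
    and sv: "singular_values n (galerkin_matrix M1 M2 H \<psi> \<phi> n) \<sigma>"
    and p: "p < n"
  shows "(\<mu> (Suc p))\<^sup>2 - (\<sigma> (Suc p))\<^sup>2 \<le> Delta_sq M1 M2 H \<psi> \<phi> n"
proof -
  have "(\<mu> (Suc p))\<^sup>2 - (\<sigma> (Suc p))\<^sup>2 \<le> (\<Sum>k<n. (\<mu> (Suc k))\<^sup>2 - (\<sigma> (Suc k))\<^sup>2)"
  proof (rule member_le_sum)
    fix k assume "k \<in> {..<n} - {p}"
    then have k: "k < n" by simp
    have "0 \<le> \<sigma> (Suc k)" using sv k by (auto simp: singular_values_def)
    then have "(\<sigma> (Suc k))\<^sup>2 \<le> (\<mu> (Suc k))\<^sup>2"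
      using galerkin_singular_value_le[OF H sve \<psi> \<phi> sv k] by (intro power_mono)
    then show "0 \<le> (\<mu> (Suc k))\<^sup>2 - (\<sigma> (Suc k))\<^sup>2" by simp
  qed (use p in auto)
  also have "\<dots> = (\<Sum>i=1..n. (\<mu> i)\<^sup>2) - (\<Sum>k<n. (\<sigma> (Suc k))\<^sup>2)"
    by (simp add: sum_subtractf sum.atLeast1_atMost_eq)
  also have "\<dots> \<le> Delta_sq M1 M2 H \<psi> \<phi> n"
    using sum_singular_values_sq_le_norm_sq[OF H sve, of n] frobenius_norm_sq_singular_values[OF _ sv]
    by (simp add: Delta_sq_def galerkin_matrix_def)
  finally show ?thesis .
qed

end

section \<open>Lebesgue domains and the numerical rank\<close>

lemma sigma_finite_lebesgue_on:
  fixes S :: "'a::euclidean_space set"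
  assumes "S \<in> sets lebesgue"
  shows "sigma_finite_measure (lebesgue_on S)"
proof -
  obtain C :: "'a set set" where C: "countable C" "C \<subseteq> sets lborel" "\<Union>C = space lborel"
      "\<forall>a\<in>C. emeasure lborel a \<noteq> \<infinity>"
    using lborel.sigma_finite_countable by blast
  have "sigma_finite_measure (lebesgue :: 'a measure)"
  proof
    show "\<exists>C. countable C \<and> C \<subseteq> sets (lebesgue :: 'a measure) \<and> \<Union>C = space (lebesgue :: 'a measure)
        \<and> (\<forall>a\<in>C. emeasure lebesgue a \<noteq> \<infinity>)"
      using C by (intro exI[of _ C]) auto
  qed
  then show ?thesis using assms by (rule sigma_finite_measure_restrict_space)
qed

lemma numerical_rank_eqI:
  assumes sv: "singular_values n A sv" and P: "1 \<le> P" "P < n"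
    and above: "\<epsilon> < sv P" and below: "sv (Suc P) \<le> \<epsilon>"
  shows "numerical_rank \<epsilon> n sv = P"
  unfolding numerical_rank_def
proof (rule Max_eqI)
  fix i assume i: "i \<in> insert 0 {i \<in> {1..n}. \<epsilon> < sv i}"
  show "i \<le> P"
  proof (rule ccontr)
    assume "\<not> i \<le> P"
    then have "sv i \<le> sv (Suc P)" using sv P i by (auto simp: singular_values_def)
    with i below \<open>\<not> i \<le> P\<close> show False by auto
  qed
qed (use P above in auto)

theorem theorem3p2:
  fixes \<Omega>s :: "'a::euclidean_space set" and \<Omega>t :: "'b::euclidean_space set"
    and H :: "'a \<Rightarrow> 'b \<Rightarrow> real"
    and \<mu> :: "nat \<Rightarrow> real" and u :: "nat \<Rightarrow> 'a \<Rightarrow> real" and v :: "nat \<Rightarrow> 'b \<Rightarrow> real"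
    and \<psi> :: "nat \<Rightarrow> 'a \<Rightarrow> real" and \<phi> :: "nat \<Rightarrow> 'b \<Rightarrow> real"
    and \<sigma> :: "nat \<Rightarrow> nat \<Rightarrow> real"
    and \<epsilon> :: real and P :: nat
  defines "Ms \<equiv> lebesgue_on \<Omega>s" and "Mt \<equiv> lebesgue_on \<Omega>t"
  assumes domains: "\<Omega>s \<in> sets lebesgue" "\<Omega>t \<in> sets lebesgue"
    and kernel: "square_integrable_kernel Ms Mt H" "\<not> degenerate_kernel Ms Mt H"
    and sve: "singular_value_expansion Ms Mt H \<mu> u v"
    and bases: "orthonormal_basis Ms \<psi>" "orthonormal_basis Mt \<phi>"
    and sv: "\<forall>n\<ge>1. singular_values n (galerkin_matrix Ms Mt H \<psi> \<phi> n) (\<sigma> n)"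
    and sv_pos: "\<forall>n\<ge>1. \<sigma> n n > 0"
    and Delta: "(\<lambda>n. Delta_sq Ms Mt H \<psi> \<phi> n) \<longlonglongrightarrow> 0"
    and distinct: "inj_on \<mu> {1..}"
    and eps: "\<epsilon> > 0"
    and P: "P \<ge> 1" "\<mu> P > \<epsilon>" "\<mu> (P + 1) \<le> \<epsilon>"
  shows "(\<lambda>n. real (numerical_rank \<epsilon> n (\<sigma> n))) \<longlonglongrightarrow> real P \<and>
         (\<exists>nstar\<ge>1. \<forall>n\<ge>nstar. numerical_rank \<epsilon> n (\<sigma> n) = P)"
proof -
  interpret pair_sigma_finite Ms Mt
    unfolding Ms_def Mt_def pair_sigma_finite_def
    using domains by (simp add: sigma_finite_lebesgue_on)
  have \<psi>: "orthonormal_system Ms \<psi>" and \<phi>: "orthonormal_system Mt \<phi>"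
    using bases by (auto simp: orthonormal_basis_def)
  have "0 < (\<mu> P)\<^sup>2 - \<epsilon>\<^sup>2"
    using P(2) eps by (simp add: power_strict_mono)
  then obtain N where N: "\<forall>n\<ge>N. Delta_sq Ms Mt H \<psi> \<phi> n < (\<mu> P)\<^sup>2 - \<epsilon>\<^sup>2"
    using order_tendstoD(2)[OF Delta] unfolding eventually_sequentially by blast
  \<comment> \<open>The matrix must have at least \<open>P + 1\<close> singular values for both inequalities to apply.\<close>
  define nstar where "nstar = max N (Suc P)"
  have rank: "numerical_rank \<epsilon> n (\<sigma> n) = P" if n: "n \<ge> nstar" for n
  proof (rule numerical_rank_eqI)
    have "P < n" "N \<le> n" using n by (auto simp: nstar_def)
    then show "P < n" and svn: "singular_values n (galerkin_matrix Ms Mt H \<psi> \<phi> n) (\<sigma> n)"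
      using sv by auto
    show "\<sigma> n (Suc P) \<le> \<epsilon>"
      using galerkin_singular_value_le[OF kernel(1) sve \<psi> \<phi> svn \<open>P < n\<close>] P(3) by simp
    have "(\<mu> P)\<^sup>2 - (\<sigma> n P)\<^sup>2 \<le> Delta_sq Ms Mt H \<psi> \<phi> n"
      using galerkin_singular_value_defect[OF kernel(1) sve \<psi> \<phi> svn, of "P - 1"] P(1) \<open>P < n\<close>
      by (simp add: less_imp_diff_less)
    then have "\<epsilon>\<^sup>2 < (\<sigma> n P)\<^sup>2" using N \<open>N \<le> n\<close> by fastforce
    moreover have "0 \<le> \<sigma> n P" using svn P(1) \<open>P < n\<close> by (auto simp: singular_values_def)
    ultimately show "\<epsilon> < \<sigma> n P" by (rule power2_less_imp_less)
  qed (fact P(1))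
  moreover have "nstar \<ge> 1" by (simp add: nstar_def)
  moreover have "(\<lambda>n. real (numerical_rank \<epsilon> n (\<sigma> n))) \<longlonglongrightarrow> real P"
    using rank by (intro tendsto_eventually) (auto simp: eventually_sequentially)
  ultimately show ?thesis by blast
qed

end
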